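(* Let $P$ be a polynomial of degree $n$ with complex coefficients, where $n\in\{3,4\}$, each of whose fixed points in $\mathbb{C}$ is simple. Suppose that all the multipliers of the fixed points of $P$ are equidistant from $1$, i.e. $|P'(z)-1|$ takes the same value at every fixed point $z$ of $P$. If $n=3$, then the fixed points of $P$ are the vertices of an equilateral triangle. If $n=4$, then the fixed points of $P$ are the vertices of a rectangle.
   Context: A fixed point of a polynomial $P$ means a finite fixed point, i.e. $z_0\in\mathbb{C}$ with $P(z_0)=z_0$; its multiplier is $P'(z_0)$. A fixed point is simple if it is a simple root of $P(z)-z$. *)

theory Defs
  imports "HOL-Analysis.Analysis" "HOL-Computational_Algebra.Computational_Algebra"
begin

definition fixed_points :: "complex poly \<Rightarrow> complex set" where
  "fixed_points P = {z. poly P z = z}"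

definition multiplier :: "complex poly \<Rightarrow> complex \<Rightarrow> complex" where
  "multiplier P z = poly (pderiv P) z"

(* [:0, 1:] is the polynomial z, so this says that z0 is a root of P(z) - z of multiplicity 1. *)
definition simple_fixed_point :: "complex poly \<Rightarrow> complex \<Rightarrow> bool" where
  "simple_fixed_point P z0 \<longleftrightarrow> z0 \<in> fixed_points P \<and> order z0 (P - [:0, 1:]) = 1"

definition equilateral_triangle_vertices :: "complex set \<Rightarrow> bool" where
  "equilateral_triangle_vertices S \<longleftrightarrow>
     (\<exists>a b c. S = {a, b, c} \<and> distinct [a, b, c] \<and>
        dist a b = dist b c \<and> dist b c = dist c a)"

(* A rectangle is a nondegenerate quadrilateral abcd, vertices in cyclic order, with four
   right angles; squares are included. *)
definition rectangle_vertices :: "complex set \<Rightarrow> bool" where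
  "rectangle_vertices S \<longleftrightarrow>
     (\<exists>a b c d. S = {a, b, c, d} \<and> distinct [a, b, c, d] \<and>
        orthogonal (d - a) (b - a) \<and> orthogonal (a - b) (c - b) \<and>
        orthogonal (b - c) (d - c) \<and> orthogonal (c - d) (a - d))"

end

theory Submission
  imports Defs
begin

text \<open>
  The fixed points of \<open>P\<close> are the roots of \<open>Q = P - z\<close>, so \<open>P' - 1\<close> takes at a fixed point \<open>z\<close> the
  value \<open>c \<Prod> (z - w)\<close>, the product being over the other fixed points \<open>w\<close>. Thus all products of
  the distances from one fixed point to the others coincide. For three points this makes the three
  distances equal. For four points it makes opposite edges of the complete quadrilateral equal in
  each of the three pairings, so the vectors \<open>a + b - c - d\<close>, \<open>a - b + c - d\<close>, \<open>a - b - c + d\<close>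
  are pairwise orthogonal; in the plane one of them vanishes, which gives a rectangle.
\<close>

text \<open>Split off the factor vanishing at \<open>z\<close>: by the product rule only the term
  that differentiates it survives there.\<close>

lemma poly_pderiv_prod_linear_factors:
  fixes c z :: "'a :: idom"
  assumes "finite A" "z \<in> A"
  shows "poly (pderiv (smult c (\<Prod>w\<in>A. [:-w, 1:]))) z = c * (\<Prod>w\<in>A - {z}. z - w)"
proof -
  define R where "R = (\<Prod>w\<in>A - {z}. [:-w, 1:])"
  have "(\<Prod>w\<in>A. [:-w, 1:]) = [:-z, 1:] * R"
    using assms by (simp only: R_def prod.remove)
  then have "poly (pderiv (smult c (\<Prod>w\<in>A. [:-w, 1:]))) z = c * poly R z"
    by (simp only: pderiv_smult pderiv_mult) (simp add: pderiv_pCons)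
  then show ?thesis
    by (simp add: R_def poly_prod)
qed

lemma equal_distance_products_triangle:
  fixes a b c :: "'a :: metric_space"
  assumes "distinct [a, b, c]"
    and "dist a b * dist a c = dist b a * dist b c"
    and "dist b a * dist b c = dist c a * dist c b"
  shows "dist a b = dist b c \<and> dist b c = dist c a"
  using assms by (auto simp: dist_commute)

text \<open>Cancelling \<open>dist a b\<close> in \<open>ab\<close> and \<open>dist c d\<close> in
  \<open>cd\<close> leaves two relations among the other four distances; their product forces
  \<open>dist a c\<close> and \<open>dist b d\<close> to have equal squares.\<close>

lemma equal_distance_products_quadrilateral:
  fixes a b c d :: "'a :: metric_space"
  assumes "distinct [a, b, c, d]"
    and ab: "dist a b * dist a c * dist a d = dist b a * dist b c * dist b d"
    and cd: "dist c a * dist c b * dist c d = dist d a * dist d b * dist d c"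
  shows "dist a c = dist b d" and "dist a d = dist b c"
proof -
  define q q' r r' where "q = dist a c" "q' = dist b d" "r = dist a d" "r' = dist b c"
  note defs = this
  have pos: "q > 0" "q' > 0" "r > 0" "r' > 0"
    using assms(1) by (auto simp: defs)
  have 1: "q * r = q' * r'"
    using ab assms(1) by (simp add: dist_commute defs)
  have 2: "q * r' = q' * r"
    using cd assms(1) by (simp add: dist_commute defs)
  have "(q * q) * (r * r') = (q' * q') * (r * r')"
    using 1 2 by (metis mult.assoc mult.commute mult.left_commute)
  then have "q\<^sup>2 = q'\<^sup>2"
    using pos by (simp add: power2_eq_square)
  then have "q = q'"
    using pos by (simp add: power2_eq_iff_nonneg)
  with 1 pos show "dist a c = dist b d" "dist a d = dist b c"
    by (auto simp: defs)
qed

text \<open>The plane has no three mutually orthogonal nonzero vectors: if \<open>x\<close> is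
  nonzero, \<open>y\<close> and \<open>z\<close> are both real multiples of
  \<open>\<i> * x\<close>.\<close>

lemma pairwise_orthogonal_complex:
  fixes x y z :: complex
  assumes "orthogonal x y" "orthogonal x z" "orthogonal y z"
  shows "x = 0 \<or> y = 0 \<or> z = 0"
proof (rule ccontr)
  assume nz: "\<not> ?thesis"
  \<comment> \<open>Expansion of \<open>y \<bullet> z\<close> in the orthogonal basis
    \<open>x\<close>, \<open>\<i> * x\<close>, cleared of denominators.\<close>
  have "(x \<bullet> x) * (y \<bullet> z) = (x \<bullet> y) * (x \<bullet> z) + ((\<i> * x) \<bullet> y) * ((\<i> * x) \<bullet> z)"
    by (simp add: inner_complex_def algebra_simps)
  then have "(\<i> * x) \<bullet> y = 0 \<or> (\<i> * x) \<bullet> z = 0"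
    using assms by (simp add: orthogonal_def)
  moreover have "w = 0" if "x \<bullet> w = 0" "(\<i> * x) \<bullet> w = 0" for w
  proof -
    have "(x \<bullet> x) * (w \<bullet> w) = (x \<bullet> w)\<^sup>2 + ((\<i> * x) \<bullet> w)\<^sup>2"
      by (simp add: inner_complex_def algebra_simps power2_eq_square)
    then show ?thesis using that nz by simp
  qed
  ultimately show False
    using assms nz by (auto simp: orthogonal_def)
qed

text \<open>With sides \<open>u = a - b\<close> and \<open>v = c - b\<close> of the parallelogram,
  the diagonals are \<open>u - v\<close> and \<open>u + v\<close>; equal lengths force
  \<open>u \<bullet> v = 0\<close>.\<close>

lemma rectangle_if_bisecting_equal_diagonals:
  fixes a b c d :: complex
  assumes "distinct [a, b, c, d]" "a + c = b + d" "dist a c = dist b d"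
  shows "rectangle_vertices {a, b, c, d}"
proof -
  have d: "d = a + c - b"
    using assms(2) by (simp add: algebra_simps)
  have "(a - c) \<bullet> (a - c) = (b - d) \<bullet> (b - d)"
    using assms(3) by (simp add: dist_norm dot_square_norm)
  then have "orthogonal (d - a) (b - a)" "orthogonal (a - b) (c - b)"
    "orthogonal (b - c) (d - c)" "orthogonal (c - d) (a - d)"
    unfolding d orthogonal_def by (auto simp: inner_complex_def algebra_simps)
  then show ?thesis
    unfolding rectangle_vertices_def using assms(1) by blast
qed

lemma rectangle_if_opposite_distances_eq:
  fixes a b c d :: complex
  assumes dist: "distinct [a, b, c, d]"
    and ab: "dist a b = dist c d" and ac: "dist a c = dist b d" and ad: "dist a d = dist b c"
  shows "rectangle_vertices {a, b, c, d}"
proof -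
  define x y z where "x = a + b - c - d" "y = a - b + c - d" "z = a - b - c + d"
  note xyz = this
  have sq: "(a - b) \<bullet> (a - b) = (c - d) \<bullet> (c - d)" "(a - c) \<bullet> (a - c) = (b - d) \<bullet> (b - d)"
    "(a - d) \<bullet> (a - d) = (b - c) \<bullet> (b - c)"
    using ab ac ad by (simp_all add: dist_norm dot_square_norm)
  \<comment> \<open>Each pair is a sum and a difference of the same two vectors, e.g.
    \<open>x\<close> and \<open>y\<close> are \<open>(a - d) + (b - c)\<close> and
    \<open>(a - d) - (b - c)\<close>, so the inner product is a difference of squared opposite
    distances.\<close>
  have "orthogonal x y" "orthogonal x z" "orthogonal y z"
    using sq unfolding xyz orthogonal_def by (auto simp: inner_simps inner_commute)
  then consider "x = 0" | "y = 0" | "z = 0"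
    using pairwise_orthogonal_complex by blast
  then show ?thesis
  proof cases
    \<comment> \<open>Here \<open>a + b = c + d\<close>, so the segments \<open>ab\<close> and
      \<open>cd\<close> are the diagonals, which fixes the cyclic order \<open>a, c, b, d\<close>.
      The other cases differ only in the pairing.\<close>
    case 1
    then have "rectangle_vertices {a, c, b, d}"
      using dist ab by (intro rectangle_if_bisecting_equal_diagonals) (auto simp: xyz algebra_simps)
    then show ?thesis by (simp add: insert_commute)
  next
    case 2
    then show ?thesis
      using dist ac by (intro rectangle_if_bisecting_equal_diagonals) (auto simp: xyz algebra_simps)
  next
    case 3
    then have "rectangle_vertices {a, b, d, c}"
      using dist ad by (intro rectangle_if_bisecting_equal_diagonals) (auto simp: xyz algebra_simps)
    then show ?thesis by (simp add: insert_commute)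
  qed
qed

text \<open>Simplicity makes \<open>P - [:0, 1:]\<close> a constant times a product of distinct
  linear factors. Its degree counts the fixed points, and its derivative at them is
  \<open>P' - 1\<close>.\<close>

lemma fixed_points_equidistant_multipliers:
  assumes deg: "degree P \<ge> 2"
    and simple: "\<forall>z\<in>fixed_points P. simple_fixed_point P z"
    and equi: "\<forall>z\<in>fixed_points P. cmod (multiplier P z - 1) = r"
  shows "card (fixed_points P) = degree P"
    and "\<exists>k. \<forall>z\<in>fixed_points P. (\<Prod>w\<in>fixed_points P - {z}. dist z w) = k"
proof -
  define Q where "Q = P - [:0, 1:]"
  have degQ: "degree Q = degree P"
    \<comment> \<open>Degree at least 2 ensures that subtracting the linear term preserves the
      degree.\<close>
    using deg unfolding Q_def diff_conv_add_uminus by (intro degree_add_eq_left) simp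
  have Q0: "Q \<noteq> 0"
    using degQ deg by auto
  have roots: "fixed_points P = {z. poly Q z = 0}"
    by (auto simp: fixed_points_def Q_def)
  have fin: "finite (fixed_points P)"
    unfolding roots using Q0 by (rule poly_roots_finite)
  have "rsquarefree Q"
    unfolding rsquarefree_def
  proof (intro conjI allI Q0)
    fix z
    show "order z Q = 0 \<or> order z Q = 1"
      using simple by (cases "z \<in> fixed_points P")
        (auto simp: simple_fixed_point_def Q_def roots intro: order_0I)
  qed
  then have fact: "smult (lead_coeff Q) (\<Prod>w\<in>fixed_points P. [:-w, 1:]) = Q"
    unfolding roots by (rule complex_poly_decompose_rsquarefree)
  have "degree Q = degree (\<Prod>w\<in>fixed_points P. [:-w, 1:])"
    by (subst fact [symmetric]) (use Q0 in simp)
  then show "card (fixed_points P) = degree P"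
    by (simp add: degQ degree_prod_eq_sum_degree)
  have "(\<Prod>w\<in>fixed_points P - {z}. dist z w) = r / cmod (lead_coeff Q)"
    if z: "z \<in> fixed_points P" for z
  proof -
    have "multiplier P z - 1 = poly (pderiv Q) z"
      by (simp add: multiplier_def Q_def pderiv_diff pderiv_pCons)
    also have "\<dots> = lead_coeff Q * (\<Prod>w\<in>fixed_points P - {z}. z - w)"
      using poly_pderiv_prod_linear_factors [OF fin z, of "lead_coeff Q"] by (simp only: fact)
    finally have "r = cmod (lead_coeff Q) * (\<Prod>w\<in>fixed_points P - {z}. dist z w)"
      using equi z by (metis norm_mult prod_norm dist_norm prod.cong)
    then show ?thesis
      using Q0 by simp
  qed
  then show "\<exists>k. \<forall>z\<in>fixed_points P. (\<Prod>w\<in>fixed_points P - {z}. dist z w) = k"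
    by blast
qed

theorem theorem3p4:
  fixes P :: "complex poly" and n :: nat
  assumes "degree P = n" and "n \<in> {3, 4}"
    and "\<forall>z \<in> fixed_points P. simple_fixed_point P z"
    and "\<exists>r. \<forall>z \<in> fixed_points P. cmod (multiplier P z - 1) = r"
  shows "(n = 3 \<longrightarrow> equilateral_triangle_vertices (fixed_points P)) \<and>
         (n = 4 \<longrightarrow> rectangle_vertices (fixed_points P))"
proof -
  obtain r where r: "\<forall>z \<in> fixed_points P. cmod (multiplier P z - 1) = r"
    using assms(4) by blast
  have "degree P \<ge> 2"
    using assms(1,2) by auto
  note fp = fixed_points_equidistant_multipliers [OF this assms(3) r]
  have card: "card (fixed_points P) = n"
    using fp(1) assms(1) by simp
  obtain k where k: "\<And>z. z \<in> fixed_points P \<Longrightarrow> (\<Prod>w\<in>fixed_points P - {z}. dist z w) = k"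
    using fp(2) by blast
  obtain zs where zs: "set zs = fixed_points P" "distinct zs" "length zs = n"
    by (metis card card_gt_0_iff assms(2) distinct_card finite_distinct_list
        insert_iff empty_iff zero_less_numeral)
  show ?thesis
  proof (intro conjI impI)
    assume "n = 3"
    then obtain a b c where "zs = [a, b, c]"
      using zs(3) by (auto simp: numeral_eq_Suc length_Suc_conv)
    with zs have S: "fixed_points P = {a, b, c}" and d: "distinct [a, b, c]"
      by auto
    have "dist a b * dist a c = k" "dist b a * dist b c = k" "dist c a * dist c b = k"
      using k [of a] k [of b] k [of c] d unfolding S by (auto simp: insert_Diff_if)
    then show "equilateral_triangle_vertices (fixed_points P)"
      using equal_distance_products_triangle [OF d] d
      unfolding S equilateral_triangle_vertices_def by metis
  next
    assume "n = 4"
    then obtain a b c d where "zs = [a, b, c, d]"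
      using zs(3) by (auto simp: numeral_eq_Suc length_Suc_conv)
    with zs have S: "fixed_points P = {a, b, c, d}" and dis: "distinct [a, b, c, d]"
      by auto
    have prods: "dist a b * dist a c * dist a d = k" "dist b a * dist b c * dist b d = k"
      "dist c a * dist c b * dist c d = k" "dist d a * dist d b * dist d c = k"
      using k [of a] k [of b] k [of c] k [of d] dis unfolding S
      by (auto simp: insert_Diff_if mult.assoc)
    have "dist a c = dist b d" "dist a d = dist b c"
      using equal_distance_products_quadrilateral [OF dis] prods by simp_all
    \<comment> \<open>The third pair follows by cancelling the two known equalities from the
      products at \<open>a\<close> and \<open>d\<close>.\<close>
    moreover from this have "dist a b = dist c d"
      using prods(1,4) dis by (auto simp: dist_commute)
    ultimately show "rectangle_vertices (fixed_points P)"
      unfolding S using rectangle_if_opposite_distances_eq [OF dis] by blast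
  qed
qed

end
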